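(* Let $\mathcal{G}$ be a groupoid, $\mathcal{H}\lhd\mathcal{G}$ and $\mathcal{K}\lhd\mathcal{G}$ with $\mathcal{K}\subseteq\mathcal{H}$. Then $\mathcal{H}/\mathcal{K}\lhd\mathcal{G}/\mathcal{K}$ and $$\frac{\mathcal{G}/\mathcal{K}}{\mathcal{H}/\mathcal{K}}\cong\mathcal{G}/\mathcal{H}.$$
   Context: A groupoid is a set $\mathcal{G}$ with a partial binary operation, written by concatenation ($\exists gh$ means that $gh$ is defined). An element $e$ is an identity if $\exists eg$ implies $eg=g$ and $\exists g'e$ implies $g'e=g'$; $\mathcal{G}_0$ is the set of identities. Axioms: (i) $\exists g(hl)$ iff $\exists (gh)l$, and then $g(hl)=(gh)l$; (ii) $\exists g(hl)$ iff $\exists gh$ and $\exists hl$; (iii) for each $g$ there are unique identities $d(g),r(g)$ with $\exists gd(g)$ and $\exists r(g)g$; (iv) for each $g$ there is $g^{-1}$ with $\exists g^{-1}g$, $\exists gg^{-1}$, $d(g)=g^{-1}g$, $r(g)=gg^{-1}$. (Thus $\exists gh$ iff $d(g)=r(h)$.) For $e\in\mathcal{G}_0$, $\mathcal{G}_e=\{g\in\mathcal{G}\mid d(g)=r(g)=e\}$. A subgroupoid is a nonempty subset closed under inverses and under defined products; it is wide if it has the same set of identities as $\mathcal{G}$. A subgroupoid $\mathcal{H}$ of $\mathcal{G}$ is normal, $\mathcal{H}\lhd\mathcal{G}$, if for all $g\in\mathcal{G}$ the set $g^{-1}\mathcal{H}g=\{g^{-1}hg\mid h\in\mathcal{H}\cap\mathcal{G}_{r(g)}\}$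 is nonempty and contained in $\mathcal{H}$ (nonemptiness for all $g$ is equivalent to $\mathcal{H}$ being wide). For $\mathcal{H}\lhd\mathcal{G}$, write $g\equiv_{\mathcal{H}}l$ iff $\exists l^{-1}g$ and $l^{-1}g\in\mathcal{H}$; the class of $g$ is the left coset $g\mathcal{H}=\{gh\mid h\in\mathcal{H},\ r(h)=d(g)\}$. The quotient groupoid $\mathcal{G}/\mathcal{H}$ is the set of all left cosets of $\mathcal{H}$ in $\mathcal{G}$, with $\exists(g\mathcal{H})(l\mathcal{H})$ iff $\exists gl$, and partial binary operation $(g\mathcal{H})(l\mathcal{H})=gl\mathcal{H}$. $\mathcal{H}/\mathcal{K}$ denotes $\{h\mathcal{K}\mid h\in\mathcal{H}\}\subseteq\mathcal{G}/\mathcal{K}$. A homomorphism of groupoids is a map $\phi$ such that $\exists xy$ implies $\exists\phi(x)\phi(y)$ and $\phi(xy)=\phi(x)\phi(y)$; an isomorphism is a bijective homomorphism, and $\cong$ means that there is an isomorphism.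
   Formalization: Adds the hypothesis that existence of (gK)(lK) does not depend on the chosen representatives (equivalently d(k)=r(k) for all k in K); without it G/K is not a groupoid, e.g. for G=H=K the pair groupoid on two points. *)

theory Defs
  imports Main
begin

text \<open>A set with a partial binary operation; \<open>pcomp G x y = Some z\<close> means that
  \<open>xy\<close> is defined and equals \<open>z\<close>, and \<open>None\<close> means that it is undefined.\<close>

record 'a pmagma =
  carrier :: "'a set"
  pcomp :: "'a \<Rightarrow> 'a \<Rightarrow> 'a option"

definition composable :: "('a, 'm) pmagma_scheme \<Rightarrow> 'a \<Rightarrow> 'a \<Rightarrow> bool" where
  "composable G x y \<longleftrightarrow> pcomp G x y \<noteq> None"

text \<open>The value of a product; only meaningful when the product is defined.\<close>

definition pmult :: "('a, 'm) pmagma_scheme \<Rightarrow> 'a \<Rightarrow> 'a \<Rightarrow> 'a" where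
  "pmult G x y = the (pcomp G x y)"

definition is_identity :: "('a, 'm) pmagma_scheme \<Rightarrow> 'a \<Rightarrow> bool" where
  "is_identity G e \<longleftrightarrow> e \<in> carrier G
     \<and> (\<forall>g. composable G e g \<longrightarrow> pmult G e g = g)
     \<and> (\<forall>g. composable G g e \<longrightarrow> pmult G g e = g)"

definition dom_id :: "('a, 'm) pmagma_scheme \<Rightarrow> 'a \<Rightarrow> 'a" where
  "dom_id G g = (THE e. is_identity G e \<and> composable G g e)"

definition ran_id :: "('a, 'm) pmagma_scheme \<Rightarrow> 'a \<Rightarrow> 'a" where
  "ran_id G g = (THE e. is_identity G e \<and> composable G e g)"

definition is_inverse :: "('a, 'm) pmagma_scheme \<Rightarrow> 'a \<Rightarrow> 'a \<Rightarrow> bool" where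
  "is_inverse G g h \<longleftrightarrow> h \<in> carrier G
     \<and> pcomp G h g = Some (dom_id G g) \<and> pcomp G g h = Some (ran_id G g)"

text \<open>The first clause says that \<open>pcomp\<close> is a partial function from pairs of elements of
  the carrier to the carrier. A nested product such as \<open>g(hl)\<close> exists iff
  \<open>hl\<close> exists and its product with \<open>g\<close> exists, so it is the option
  \<open>Option.bind (pcomp G h l) (pcomp G g)\<close>; the equation of options in the second
  clause states that the two nested products exist simultaneously and then agree.\<close>

definition groupoid :: "('a, 'm) pmagma_scheme \<Rightarrow> bool" where
  "groupoid G \<longleftrightarrow>
     (\<forall>x y z. pcomp G x y = Some z \<longrightarrow> x \<in> carrier G \<and> y \<in> carrier G \<and> z \<in> carrier G)
   \<and> (\<forall>g\<in>carrier G. \<forall>h\<in>carrier G. \<forall>l\<in>carrier G.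
        Option.bind (pcomp G h l) (\<lambda>x. pcomp G g x) = Option.bind (pcomp G g h) (\<lambda>x. pcomp G x l))
   \<and> (\<forall>g\<in>carrier G. \<forall>h\<in>carrier G. \<forall>l\<in>carrier G.
        Option.bind (pcomp G h l) (\<lambda>x. pcomp G g x) \<noteq> None
          \<longleftrightarrow> composable G g h \<and> composable G h l)
   \<and> (\<forall>g\<in>carrier G. (\<exists>!e. is_identity G e \<and> composable G g e)
                   \<and> (\<exists>!e. is_identity G e \<and> composable G e g))
   \<and> (\<forall>g\<in>carrier G. \<exists>h. is_inverse G g h)"

text \<open>In a groupoid the inverse is unique.\<close>

definition pinv :: "('a, 'm) pmagma_scheme \<Rightarrow> 'a \<Rightarrow> 'a" where
  "pinv G g = (THE h. is_inverse G g h)"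

definition isotropy :: "('a, 'm) pmagma_scheme \<Rightarrow> 'a \<Rightarrow> 'a set" where
  "isotropy G e = {g \<in> carrier G. dom_id G g = e \<and> ran_id G g = e}"

definition subgroupoid :: "'a set \<Rightarrow> ('a, 'm) pmagma_scheme \<Rightarrow> bool" where
  "subgroupoid H G \<longleftrightarrow> groupoid G \<and> H \<subseteq> carrier G \<and> H \<noteq> {}
     \<and> (\<forall>h\<in>H. pinv G h \<in> H)
     \<and> (\<forall>h\<in>H. \<forall>k\<in>H. composable G h k \<longrightarrow> pmult G h k \<in> H)"

text \<open>The set \<open>g\<inverse>Hg\<close>; the products below are defined because \<open>h\<close> lies in the
  isotropy group at the range of \<open>g\<close>.\<close>

definition conjugate_set :: "('a, 'm) pmagma_scheme \<Rightarrow> 'a set \<Rightarrow> 'a \<Rightarrow> 'a set" where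
  "conjugate_set G H g =
     (\<lambda>h. pmult G (pmult G (pinv G g) h) g) ` (H \<inter> isotropy G (ran_id G g))"

definition normal_subgroupoid :: "'a set \<Rightarrow> ('a, 'm) pmagma_scheme \<Rightarrow> bool" where
  "normal_subgroupoid H G \<longleftrightarrow> subgroupoid H G
     \<and> (\<forall>g\<in>carrier G. conjugate_set G H g \<noteq> {} \<and> conjugate_set G H g \<subseteq> H)"

definition left_coset :: "('a, 'm) pmagma_scheme \<Rightarrow> 'a set \<Rightarrow> 'a \<Rightarrow> 'a set" where
  "left_coset G H g = {pmult G g h | h. h \<in> H \<and> ran_id G h = dom_id G g}"

text \<open>The image \<open>{hK | h \<in> H}\<close> of a subset in the quotient by \<open>K\<close>.\<close>

definition coset_image :: "('a, 'm) pmagma_scheme \<Rightarrow> 'a set \<Rightarrow> 'a set \<Rightarrow> 'a set set" where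
  "coset_image G K H = left_coset G K ` H"

text \<open>\<open>coset_product G H A B C\<close>: for some representatives \<open>g\<close> of \<open>A\<close> and \<open>l\<close> of \<open>B\<close>,
  the product \<open>gl\<close> exists and \<open>C = glH\<close>. For normal \<open>H\<close> the cosets \<open>A\<close> and \<open>B\<close>
  determine \<open>C\<close>, if there is one.\<close>

definition coset_product ::
    "('a, 'm) pmagma_scheme \<Rightarrow> 'a set \<Rightarrow> 'a set \<Rightarrow> 'a set \<Rightarrow> 'a set \<Rightarrow> bool" where
  "coset_product G H A B C \<longleftrightarrow>
     (\<exists>g\<in>carrier G. \<exists>l\<in>carrier G. A = left_coset G H g \<and> B = left_coset G H l
        \<and> composable G g l \<and> C = left_coset G H (pmult G g l))"

definition quotient_groupoid :: "('a, 'm) pmagma_scheme \<Rightarrow> 'a set \<Rightarrow> 'a set pmagma" where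
  "quotient_groupoid G H =
     \<lparr>carrier = left_coset G H ` carrier G,
      pcomp = (\<lambda>A B. if \<exists>C. coset_product G H A B C
                     then Some (THE C. coset_product G H A B C) else None)\<rparr>"

text \<open>Existence of \<open>(gH)(lH)\<close> is prescribed by existence of \<open>gl\<close>, which presupposes that
  the latter depends only on the cosets. Normality does not guarantee this: if \<open>H\<close> contains
  an \<open>h\<close> with distinct domain and range \<open>e\<close>, then \<open>hH = eH\<close> and \<open>ee\<close> exists, but \<open>he\<close>
  does not. In that case \<open>quotient_groupoid G H\<close> need not be a groupoid.\<close>

definition quotient_composability_well_defined ::
    "('a, 'm) pmagma_scheme \<Rightarrow> 'a set \<Rightarrow> bool" where
  "quotient_composability_well_defined G H \<longleftrightarrow>
     (\<forall>g\<in>carrier G. \<forall>g'\<in>carrier G. \<forall>l\<in>carrier G. \<forall>l'\<in>carrier G.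
        left_coset G H g = left_coset G H g' \<longrightarrow> left_coset G H l = left_coset G H l'
        \<longrightarrow> (composable G g l \<longleftrightarrow> composable G g' l'))"

definition groupoid_hom ::
    "('a, 'm) pmagma_scheme \<Rightarrow> ('b, 'n) pmagma_scheme \<Rightarrow> ('a \<Rightarrow> 'b) \<Rightarrow> bool" where
  "groupoid_hom G G' \<phi> \<longleftrightarrow> \<phi> ` carrier G \<subseteq> carrier G'
     \<and> (\<forall>x\<in>carrier G. \<forall>y\<in>carrier G. composable G x y \<longrightarrow>
          composable G' (\<phi> x) (\<phi> y) \<and> \<phi> (pmult G x y) = pmult G' (\<phi> x) (\<phi> y))"

definition groupoid_isomorphic ::
    "('a, 'm) pmagma_scheme \<Rightarrow> ('b, 'n) pmagma_scheme \<Rightarrow> bool" where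
  "groupoid_isomorphic G G' \<longleftrightarrow>
     (\<exists>\<phi>. groupoid_hom G G' \<phi> \<and> bij_betw \<phi> (carrier G) (carrier G'))"

end

theory Submission
  imports Defs
begin

text \<open>
  As for groups, the isomorphism sends \<open>(gK)(H/K)\<close> to \<open>gH\<close>. It is convenient that this map
  needs no choice of representatives. The coset of \<open>H/K\<close> in \<open>G/K\<close> that contains \<open>gK\<close> is the
  set \<open>{xK | x \<in> gH}\<close> (lemma \<open>coset_of_cosets\<close>), and since \<open>K \<subseteq> H\<close> the union of these
  \<open>xK\<close> is \<open>gH\<close> again (lemma \<open>Union_cosets\<close>). Hence the set-theoretic union is a bijection
  \<open>(G/K)/(H/K) \<rightarrow> G/H\<close>, and it respects products because both products are computed on
  representatives.

  Two points separate the groupoid case from the group case. Firstly, the existence of a product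
  in \<open>G/K\<close> is required to depend only on the cosets. For a normal \<open>K\<close> this forces every \<open>k \<in> K\<close> to have
  equal domain and range (lemma \<open>sub_isotropic\<close>): \<open>k\<close> and \<open>r(k)\<close> lie in the same coset, and
  \<open>r(k)r(k)\<close> exists. So domain and range are constant on each coset of \<open>K\<close>, the product
  of \<open>gK\<close> and \<open>lK\<close> exists exactly when \<open>d(g) = r(l)\<close>, and \<open>G/K\<close> is a groupoid.
  Secondly, elements of \<open>H\<close> may join different identities, so \<open>G/H\<close> need not be a groupoid.
  It is still true that the value of \<open>(gH)(lH)\<close> is the same for all composable
  representatives (lemma \<open>coset_product_unique\<close>), and a bijective homomorphism asks for no
  more than that: it has to carry existing products to existing products.
\<close>

section \<open>Calculus in a groupoid\<close>

locale groupoid_calculus =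
  fixes G :: "'a pmagma"
  assumes groupoid: "groupoid G"
begin

abbreviation mult (infixl "\<cdot>" 70) where "g \<cdot> h \<equiv> pmult G g h"
abbreviation dom ("\<d>") where "\<d> g \<equiv> dom_id G g"
abbreviation ran ("\<r>") where "\<r> g \<equiv> ran_id G g"
abbreviation inverse ("\<i>") where "\<i> g \<equiv> pinv G g"

lemma pcomp_composable: "composable G g h \<Longrightarrow> pcomp G g h = Some (g \<cdot> h)"
  by (auto simp: composable_def pmult_def)

lemma composable_closed:
  assumes "composable G g h"
  shows "g \<in> carrier G" "h \<in> carrier G" "g \<cdot> h \<in> carrier G"
  using groupoid pcomp_composable[OF assms] unfolding groupoid_def by metis+

lemma bind_assoc:
  assumes "g \<in> carrier G" "h \<in> carrier G" "l \<in> carrier G"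
  shows "Option.bind (pcomp G h l) (pcomp G g) = Option.bind (pcomp G g h) (\<lambda>x. pcomp G x l)"
  using groupoid assms unfolding groupoid_def by blast

lemma bind_exists:
  assumes "g \<in> carrier G" "h \<in> carrier G" "l \<in> carrier G"
  shows "Option.bind (pcomp G h l) (pcomp G g) \<noteq> None \<longleftrightarrow> composable G g h \<and> composable G h l"
  using groupoid assms unfolding groupoid_def by blast

text \<open>Both axioms on nested products are used here: existence of \<open>(gh)l\<close> is transported to
  existence of \<open>g(hl)\<close>, which in turn is decided by its two factors. The dual statement
  on \<open>g(hl)\<close> is a direct instance of the axiom on its existence.\<close>

lemma composable_left_iff:
  assumes "composable G g h"
  shows "composable G (g \<cdot> h) l \<longleftrightarrow> composable G h l"
proof
  assume a: "composable G (g \<cdot> h) l"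
  note c = composable_closed[OF assms] composable_closed[OF a]
  show "composable G h l"
    using bind_assoc[of g h l] bind_exists[of g h l] c pcomp_composable[OF assms] pcomp_composable[OF a]
    by auto
next
  assume a: "composable G h l"
  note c = composable_closed[OF assms] composable_closed[OF a]
  have "Option.bind (pcomp G g h) (\<lambda>x. pcomp G x l) \<noteq> None"
    using bind_assoc[of g h l] bind_exists[of g h l] c assms a by metis
  then show "composable G (g \<cdot> h) l"
    using pcomp_composable[OF assms] by (simp add: composable_def)
qed

lemma composable_right_iff:
  assumes "composable G h l"
  shows "composable G g (h \<cdot> l) \<longleftrightarrow> composable G g h"
proof
  assume a: "composable G g (h \<cdot> l)"
  note c = composable_closed[OF assms] composable_closed[OF a]
  show "composable G g h"
    using bind_exists[of g h l] c pcomp_composable[OF assms] pcomp_composable[OF a]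
    by auto
next
  assume a: "composable G g h"
  note c = composable_closed[OF assms] composable_closed[OF a]
  have "Option.bind (pcomp G h l) (pcomp G g) \<noteq> None"
    using bind_exists[of g h l] c assms a by metis
  then show "composable G g (h \<cdot> l)"
    using pcomp_composable[OF assms] by (simp add: composable_def)
qed

lemma composable_assoc:
  assumes "composable G g h" "composable G h l"
  shows "g \<cdot> h \<cdot> l = g \<cdot> (h \<cdot> l)"
proof -
  have "pcomp G (g \<cdot> h) l = Some (g \<cdot> h \<cdot> l)" "pcomp G g (h \<cdot> l) = Some (g \<cdot> (h \<cdot> l))"
    using assms composable_left_iff composable_right_iff pcomp_composable by blast+
  then show ?thesis
    using bind_assoc[of g h l] assms composable_closed pcomp_composable by simp
qed

lemma dom_ex1: "g \<in> carrier G \<Longrightarrow> \<exists>!e. is_identity G e \<and> composable G g e"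
  and ran_ex1: "g \<in> carrier G \<Longrightarrow> \<exists>!e. is_identity G e \<and> composable G e g"
  using groupoid unfolding groupoid_def by blast+

lemma dom_props:
  assumes "g \<in> carrier G"
  shows "is_identity G (\<d> g)" "composable G g (\<d> g)"
  using theI'[OF dom_ex1[OF assms]] unfolding dom_id_def by auto

lemma ran_props:
  assumes "g \<in> carrier G"
  shows "is_identity G (\<r> g)" "composable G (\<r> g) g"
  using theI'[OF ran_ex1[OF assms]] unfolding ran_id_def by auto

lemma dom_eqI: "is_identity G e \<Longrightarrow> composable G g e \<Longrightarrow> \<d> g = e"
  using dom_ex1 dom_props composable_closed by metis

lemma ran_eqI: "is_identity G e \<Longrightarrow> composable G e g \<Longrightarrow> \<r> g = e"
  using ran_ex1 ran_props composable_closed by metis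

lemma mult_dom [simp]: "g \<in> carrier G \<Longrightarrow> g \<cdot> \<d> g = g"
  and mult_ran [simp]: "g \<in> carrier G \<Longrightarrow> \<r> g \<cdot> g = g"
  using dom_props ran_props unfolding is_identity_def by blast+

lemma dom_closed [simp]: "g \<in> carrier G \<Longrightarrow> \<d> g \<in> carrier G"
  and ran_closed [simp]: "g \<in> carrier G \<Longrightarrow> \<r> g \<in> carrier G"
  using dom_props ran_props unfolding is_identity_def by blast+

text \<open>If \<open>gh\<close> exists, write \<open>g = g d(g)\<close>; then \<open>d(g)h\<close> exists, and \<open>r(h)\<close> is the only
  identity with this property. Conversely \<open>g r(h)\<close> and \<open>r(h)h = h\<close> exist when
  \<open>d(g) = r(h)\<close>, hence so does \<open>gh\<close>.\<close>

theorem composable_iff: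
  "composable G g h \<longleftrightarrow> g \<in> carrier G \<and> h \<in> carrier G \<and> \<d> g = \<r> h"
proof
  assume a: "composable G g h"
  note c = composable_closed[OF a]
  have "composable G (\<d> g) h"
    using composable_left_iff[OF dom_props(2)[OF c(1)], of h] a c by simp
  then show "g \<in> carrier G \<and> h \<in> carrier G \<and> \<d> g = \<r> h"
    using c ran_eqI dom_props by metis
next
  assume a: "g \<in> carrier G \<and> h \<in> carrier G \<and> \<d> g = \<r> h"
  then have "composable G g (\<r> h)" "composable G (\<r> h) h"
    using dom_props[of g] ran_props[of h] by auto
  then show "composable G g h" using composable_right_iff[of "\<r> h" h g] a by simp
qed

lemma mult_closed [simp]:
  "g \<in> carrier G \<Longrightarrow> h \<in> carrier G \<Longrightarrow> \<d> g = \<r> h \<Longrightarrow> g \<cdot> h \<in> carrier G"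
  using composable_closed composable_iff by blast

lemma dom_mult [simp]:
  assumes "g \<in> carrier G" "h \<in> carrier G" "\<d> g = \<r> h"
  shows "\<d> (g \<cdot> h) = \<d> h"
  by (metis assms composable_iff composable_left_iff dom_eqI dom_props)

lemma ran_mult [simp]:
  assumes "g \<in> carrier G" "h \<in> carrier G" "\<d> g = \<r> h"
  shows "\<r> (g \<cdot> h) = \<r> g"
  by (metis assms composable_iff composable_right_iff ran_eqI ran_props)

lemma mult_assoc:
  assumes "g \<in> carrier G" "h \<in> carrier G" "l \<in> carrier G" "\<d> g = \<r> h" "\<d> h = \<r> l"
  shows "g \<cdot> h \<cdot> l = g \<cdot> (h \<cdot> l)"
  using assms composable_assoc composable_iff by simp

lemma identity_dom_ran:
  assumes "is_identity G e"
  shows "\<d> e = e" "\<r> e = e"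
proof -
  have e: "e \<in> carrier G" using assms by (simp add: is_identity_def)
  have "\<r> e \<cdot> e = \<r> e" using assms ran_props(2)[OF e] unfolding is_identity_def by blast
  then show r: "\<r> e = e" using e by simp
  have "e \<cdot> \<d> e = \<d> e" using assms dom_props(2)[OF e] unfolding is_identity_def by blast
  then show "\<d> e = e" using e by simp
qed

lemma dom_ran_simps [simp]:
  assumes "g \<in> carrier G"
  shows "\<d> (\<d> g) = \<d> g" "\<r> (\<d> g) = \<d> g" "\<d> (\<r> g) = \<r> g" "\<r> (\<r> g) = \<r> g"
  using identity_dom_ran dom_props(1)[OF assms] ran_props(1)[OF assms] by auto

lemma is_inverse_iff:
  assumes "g \<in> carrier G"
  shows "is_inverse G g h \<longleftrightarrow> h \<in> carrier G \<and> \<d> h = \<r> g \<and> \<r> h = \<d> g \<and> h \<cdot> g = \<d> g \<and> g \<cdot> h = \<r> g"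
    (is "_ \<longleftrightarrow> ?R")
proof
  assume i: "is_inverse G g h"
  then have "composable G h g" "composable G g h" "h \<cdot> g = \<d> g" "g \<cdot> h = \<r> g" "h \<in> carrier G"
    by (auto simp: is_inverse_def composable_def pmult_def)
  then show ?R using composable_iff by auto
next
  assume ?R
  then show "is_inverse G g h"
    using assms pcomp_composable composable_iff by (simp add: is_inverse_def)
qed

lemma inverse_unique:
  assumes g: "g \<in> carrier G" and h: "is_inverse G g h" and k: "is_inverse G g k"
  shows "h = k"
proof -
  note hk = h[unfolded is_inverse_iff[OF g]] k[unfolded is_inverse_iff[OF g]]
  have "h = h \<cdot> (g \<cdot> k)" using hk mult_dom[of h] by simp
  also have "\<dots> = h \<cdot> g \<cdot> k" using hk g mult_assoc[of h g k] by simp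
  also have "\<dots> = k" using hk mult_ran[of k] by simp
  finally show ?thesis .
qed

lemma pinv_eqI: "g \<in> carrier G \<Longrightarrow> is_inverse G g h \<Longrightarrow> \<i> g = h"
  unfolding pinv_def using inverse_unique by blast

lemma pinv_is_inverse: "g \<in> carrier G \<Longrightarrow> is_inverse G g (\<i> g)"
  using groupoid pinv_eqI unfolding groupoid_def by metis

lemma inverse_simps [simp]:
  assumes "g \<in> carrier G"
  shows "\<i> g \<in> carrier G" "\<d> (\<i> g) = \<r> g" "\<r> (\<i> g) = \<d> g" "\<i> g \<cdot> g = \<d> g" "g \<cdot> \<i> g = \<r> g"
  using pinv_is_inverse[OF assms] is_inverse_iff[OF assms] by auto

end

section \<open>Left cosets of a normal subgroupoid\<close>

locale normal_calculus = groupoid_calculus +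
  fixes H :: "'a set"
  assumes normal: "normal_subgroupoid H G"
begin

abbreviation coset where "coset g \<equiv> left_coset G H g"

lemma sub_closed [simp]: "h \<in> H \<Longrightarrow> h \<in> carrier G"
  and sub_inverse [simp]: "h \<in> H \<Longrightarrow> \<i> h \<in> H"
  using normal unfolding normal_subgroupoid_def subgroupoid_def by auto

lemma sub_mult [simp]: "h \<in> H \<Longrightarrow> k \<in> H \<Longrightarrow> \<d> h = \<r> k \<Longrightarrow> h \<cdot> k \<in> H"
  using normal sub_closed composable_iff unfolding normal_subgroupoid_def subgroupoid_def by blast

lemma conjugate_closed:
  assumes "g \<in> carrier G" "h \<in> H" "\<d> h = \<r> g" "\<r> h = \<r> g"
  shows "\<i> g \<cdot> h \<cdot> g \<in> H"
proof -
  have "\<i> g \<cdot> h \<cdot> g \<in> conjugate_set G H g"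
    using assms unfolding conjugate_set_def isotropy_def by auto
  then show ?thesis using normal assms(1) unfolding normal_subgroupoid_def by blast
qed

text \<open>A nonempty conjugate at \<open>x\<close> supplies some \<open>h \<in> H\<close> that starts and ends at \<open>r(x)\<close>,
  and \<open>h h\<inverse> = r(x)\<close>.\<close>

lemma wide:
  assumes "g \<in> carrier G"
  shows "\<r> g \<in> H" "\<d> g \<in> H"
proof -
  have r: "\<r> x \<in> H" if x: "x \<in> carrier G" for x
  proof -
    obtain h where "h \<in> H" "\<r> h = \<r> x"
      using normal x unfolding normal_subgroupoid_def conjugate_set_def isotropy_def by fastforce
    then show ?thesis using sub_mult[of h "\<i> h"] by simp
  qed
  show "\<r> g \<in> H" "\<d> g \<in> H" using r[OF assms] r[OF dom_closed[OF assms]] assms by auto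
qed

lemma coset_memI: "h \<in> H \<Longrightarrow> \<r> h = \<d> g \<Longrightarrow> g \<cdot> h \<in> coset g"
  unfolding left_coset_def by blast

lemma coset_memE:
  assumes "x \<in> coset g"
  obtains h where "h \<in> H" "\<r> h = \<d> g" "x = g \<cdot> h"
  using assms unfolding left_coset_def by blast

lemma self_in_coset: "g \<in> carrier G \<Longrightarrow> g \<in> coset g"
  using coset_memI[of "\<d> g" g] wide by simp

lemma coset_subset: "g \<in> carrier G \<Longrightarrow> coset g \<subseteq> carrier G"
  by (auto elim!: coset_memE)

lemma coset_mult_subset:
  assumes "g \<in> carrier G" "h \<in> H" "\<r> h = \<d> g"
  shows "coset (g \<cdot> h) \<subseteq> coset g"
proof
  fix x assume "x \<in> coset (g \<cdot> h)"
  then obtain k where "k \<in> H" "\<r> k = \<d> (g \<cdot> h)" "x = g \<cdot> h \<cdot> k" by (rule coset_memE)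
  then show "x \<in> coset g" using assms coset_memI[of "h \<cdot> k" g] by (simp add: mult_assoc)
qed

lemma coset_mult:
  assumes "g \<in> carrier G" "h \<in> H" "\<r> h = \<d> g"
  shows "coset (g \<cdot> h) = coset g"
proof
  have "g \<cdot> h \<cdot> \<i> h = g" using assms by (simp add: mult_assoc)
  then show "coset g \<subseteq> coset (g \<cdot> h)"
    using coset_mult_subset[of "g \<cdot> h" "\<i> h"] assms by simp
qed (rule coset_mult_subset[OF assms])

lemma coset_eq_iff:
  assumes "g \<in> carrier G" "g' \<in> carrier G"
  shows "coset g = coset g' \<longleftrightarrow> g' \<in> coset g"
  using self_in_coset assms coset_mult by (metis coset_memE)

text \<open>Write \<open>g' = gh\<close> and \<open>l' = lk\<close> with \<open>h, k \<in> H\<close>. That both \<open>gl\<close> and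
  \<open>g'l'\<close> exist makes \<open>h\<close> an isotropy element at \<open>r(l)\<close>, so normality applies to
  \<open>c = l\<inverse>hl\<close>, and \<open>g'l' = g(hl)k = gl(ck)\<close>.\<close>

lemma coset_product_unique:
  assumes gl: "g \<in> carrier G" "l \<in> carrier G" "\<d> g = \<r> l"
    and gl': "g' \<in> carrier G" "l' \<in> carrier G" "\<d> g' = \<r> l'"
    and eq: "coset g = coset g'" "coset l = coset l'"
  shows "coset (g \<cdot> l) = coset (g' \<cdot> l')"
proof -
  obtain h where h: "h \<in> H" "\<r> h = \<d> g" "g' = g \<cdot> h"
    using coset_eq_iff gl gl' eq by (meson coset_memE)
  obtain k where k: "k \<in> H" "\<r> k = \<d> l" "l' = l \<cdot> k"
    using coset_eq_iff gl gl' eq by (meson coset_memE)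
  have rl: "\<r> l' = \<r> l" using gl k by simp
  have dh: "\<d> h = \<r> l" using gl h gl'(3) rl by simp
  define c where "c = \<i> l \<cdot> h \<cdot> l"
  have c: "c \<in> H" "\<r> c = \<d> l" "\<d> c = \<d> l"
    unfolding c_def using conjugate_closed[of l h] dh h gl by auto
  have "l \<cdot> c = h \<cdot> l"
  proof -
    have "l \<cdot> c = l \<cdot> \<i> l \<cdot> (h \<cdot> l)" unfolding c_def
      using dh h gl mult_assoc[of "\<i> l" h l] mult_assoc[of l "\<i> l" "h \<cdot> l"] by simp
    also have "\<dots> = h \<cdot> l" using dh h gl mult_ran[of "h \<cdot> l"] by simp
    finally show ?thesis .
  qed
  then have "g' \<cdot> l' = g \<cdot> l \<cdot> (c \<cdot> k)"
    using h k gl dh c mult_assoc[of l c k] by (simp add: mult_assoc)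
  then show ?thesis using coset_mult[of "g \<cdot> l" "c \<cdot> k"] c k gl by simp
qed

lemma quotient_carrier: "carrier (quotient_groupoid G H) = coset ` carrier G"
  by (simp add: quotient_groupoid_def)

lemma quotient_pcomp:
  assumes "g \<in> carrier G" "l \<in> carrier G" "\<d> g = \<r> l"
  shows "pcomp (quotient_groupoid G H) (coset g) (coset l) = Some (coset (g \<cdot> l))"
proof -
  have ex: "coset_product G H (coset g) (coset l) (coset (g \<cdot> l))"
    unfolding coset_product_def using assms composable_iff by blast
  have "C = coset (g \<cdot> l)" if C: "coset_product G H (coset g) (coset l) C" for C
  proof -
    obtain g' l' where *: "g' \<in> carrier G" "l' \<in> carrier G" "coset g = coset g'" "coset l = coset l'"
      "composable G g' l'" "C = coset (g' \<cdot> l')"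
      using C unfolding coset_product_def by blast
    then show ?thesis using coset_product_unique[of g l g' l'] assms composable_iff by simp
  qed
  then have "(THE C. coset_product G H (coset g) (coset l) C) = coset (g \<cdot> l)"
    using ex by (intro the_equality)
  then show ?thesis using ex by (auto simp: quotient_groupoid_def)
qed

lemma quotient_composableE:
  assumes "composable (quotient_groupoid G H) A B"
  obtains g l where "g \<in> carrier G" "l \<in> carrier G" "\<d> g = \<r> l" "A = coset g" "B = coset l"
    "pmult (quotient_groupoid G H) A B = coset (g \<cdot> l)"
proof -
  have "\<exists>C. coset_product G H A B C"
    using assms by (auto simp: composable_def quotient_groupoid_def split: if_splits)
  then obtain g l where "g \<in> carrier G" "l \<in> carrier G" "\<d> g = \<r> l" "A = coset g" "B = coset l"
    unfolding coset_product_def using composable_iff by blast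
  then show ?thesis using that quotient_pcomp by (simp add: pmult_def)
qed

end

section \<open>The quotient by a bundle of isotropy groups\<close>

text \<open>The name of the locale records the consequence of its assumption that is used
  throughout: such a subgroupoid lies in the union of the isotropy groups.\<close>

locale isotropic_calculus = normal_calculus +
  assumes well_defined: "quotient_composability_well_defined G H"
begin

abbreviation Q where "Q \<equiv> quotient_groupoid G H"

text \<open>Here \<open>hH = r(h)H\<close>, and \<open>r(h)r(h)\<close> exists, so \<open>h r(h)\<close> exists as well.\<close>

lemma sub_isotropic:
  assumes "h \<in> H"
  shows "\<d> h = \<r> h"
proof -
  have "coset (\<r> h) = coset h" using coset_mult[of "\<r> h" h] assms by simp
  then have "composable G (\<r> h) (\<r> h) \<longleftrightarrow> composable G h (\<r> h)"
    using well_defined assms unfolding quotient_composability_well_defined_def by auto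
  then show ?thesis using assms composable_iff by simp
qed

lemma coset_eq_dom_ran:
  assumes "g \<in> carrier G" "g' \<in> carrier G" "coset g = coset g'"
  shows "\<d> g = \<d> g'" "\<r> g = \<r> g'"
proof -
  obtain h where "h \<in> H" "\<r> h = \<d> g" "g' = g \<cdot> h"
    using coset_eq_iff assms by (meson coset_memE)
  then show "\<d> g = \<d> g'" "\<r> g = \<r> g'" using sub_isotropic[of h] assms by auto
qed

lemma quotient_composable_iff:
  assumes "g \<in> carrier G" "l \<in> carrier G"
  shows "composable Q (coset g) (coset l) \<longleftrightarrow> \<d> g = \<r> l"
proof
  assume "composable Q (coset g) (coset l)"
  then obtain g' l' where "g' \<in> carrier G" "l' \<in> carrier G" "\<d> g' = \<r> l'"
    "coset g = coset g'" "coset l = coset l'" by (rule quotient_composableE)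
  then show "\<d> g = \<r> l" using coset_eq_dom_ran[of g g'] coset_eq_dom_ran[of l l'] assms by simp
qed (use assms quotient_pcomp in \<open>simp add: composable_def\<close>)

lemma quotient_pcomp_if:
  assumes "g \<in> carrier G" "l \<in> carrier G"
  shows "pcomp Q (coset g) (coset l) = (if \<d> g = \<r> l then Some (coset (g \<cdot> l)) else None)"
  using quotient_pcomp quotient_composable_iff[OF assms] assms
  by (cases "\<d> g = \<r> l") (simp_all add: composable_def)

lemma quotient_pmult:
  assumes "g \<in> carrier G" "l \<in> carrier G" "\<d> g = \<r> l"
  shows "pmult Q (coset g) (coset l) = coset (g \<cdot> l)"
  using quotient_pcomp assms by (simp add: pmult_def)

text \<open>If \<open>xH\<close> is an identity of the quotient, then its product with \<open>d(x)H\<close> equals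
  \<open>xH\<close> by computation and \<open>d(x)H\<close> by the identity law.\<close>

lemma quotient_identity_iff:
  "is_identity Q E \<longleftrightarrow> (\<exists>e\<in>carrier G. \<d> e = e \<and> E = coset e)"
proof
  assume E: "is_identity Q E"
  then obtain x where x: "x \<in> carrier G" "E = coset x"
    by (auto simp: is_identity_def quotient_carrier)
  have "pmult Q (coset x) (coset (\<d> x)) = coset (\<d> x)"
    using E x quotient_composable_iff[of x "\<d> x"] by (auto simp: is_identity_def)
  then have "E = coset (\<d> x)" using x quotient_pmult[of x "\<d> x"] by simp
  then show "\<exists>e\<in>carrier G. \<d> e = e \<and> E = coset e"
    using x(1) by (intro bexI[of _ "\<d> x"]) simp_all
next
  assume "\<exists>e\<in>carrier G. \<d> e = e \<and> E = coset e"
  then obtain e where e: "e \<in> carrier G" "\<d> e = e" "E = coset e" by blast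
  have re: "\<r> e = e" using dom_ran_simps(2)[OF e(1)] e by simp
  have "pmult Q E A = A" if a: "composable Q E A" for A
  proof -
    obtain l where l: "l \<in> carrier G" "A = coset l" using a by (meson quotient_composableE)
    have "e = \<r> l" using a e l quotient_composable_iff by simp
    then show ?thesis using quotient_pmult[of e l] e l by simp
  qed
  moreover have "pmult Q A E = A" if a: "composable Q A E" for A
  proof -
    obtain l where l: "l \<in> carrier G" "A = coset l" using a by (meson quotient_composableE)
    have "e = \<d> l" using a e l re quotient_composable_iff by simp
    then show ?thesis using quotient_pmult[OF l(1) e(1)] re mult_dom[OF l(1)]
      unfolding l(2) e(3) by metis
  qed
  ultimately show "is_identity Q E" using e by (auto simp: is_identity_def quotient_carrier)
qed

lemma identity_composable_iff:
  assumes "g \<in> carrier G"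
  shows "is_identity Q E \<and> composable Q (coset g) E \<longleftrightarrow> E = coset (\<d> g)"
    and "is_identity Q E \<and> composable Q E (coset g) \<longleftrightarrow> E = coset (\<r> g)"
proof -
  have r: "\<r> e = e" if "e \<in> carrier G" "\<d> e = e" for e
    using dom_ran_simps(2)[OF that(1)] that by simp
  show "is_identity Q E \<and> composable Q (coset g) E \<longleftrightarrow> E = coset (\<d> g)"
    unfolding quotient_identity_iff using assms r quotient_composable_iff
    by (metis dom_closed dom_ran_simps(1))
  show "is_identity Q E \<and> composable Q E (coset g) \<longleftrightarrow> E = coset (\<r> g)"
    unfolding quotient_identity_iff using assms quotient_composable_iff
    by (metis ran_closed dom_ran_simps(3))
qed

lemma quotient_dom: "g \<in> carrier G \<Longrightarrow> dom_id Q (coset g) = coset (\<d> g)"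
  and quotient_ran: "g \<in> carrier G \<Longrightarrow> ran_id Q (coset g) = coset (\<r> g)"
  by (simp_all add: dom_id_def ran_id_def identity_composable_iff)

lemma quotient_is_inverse: "g \<in> carrier G \<Longrightarrow> is_inverse Q (coset g) (coset (\<i> g))"
  by (simp add: is_inverse_def quotient_carrier quotient_dom quotient_ran quotient_pcomp)

text \<open>All axioms are read off from representatives, because both the existence and the value of
  a product of cosets are.\<close>

theorem quotient_groupoid: "groupoid Q"
proof -
  have closed: "A \<in> carrier Q \<and> B \<in> carrier Q \<and> C \<in> carrier Q" if "pcomp Q A B = Some C" for A B C
  proof -
    have "composable Q A B" "pmult Q A B = C" using that by (auto simp: composable_def pmult_def)
    then show ?thesis by (auto elim!: quotient_composableE simp: quotient_carrier)
  qed
  have assoc: "Option.bind (pcomp Q B C) (pcomp Q A) = Option.bind (pcomp Q A B) (\<lambda>X. pcomp Q X C)"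
    and exists: "Option.bind (pcomp Q B C) (pcomp Q A) \<noteq> None \<longleftrightarrow> composable Q A B \<and> composable Q B C"
    if ABC: "A \<in> carrier Q" "B \<in> carrier Q" "C \<in> carrier Q" for A B C
  proof -
    obtain g h l where *: "g \<in> carrier G" "h \<in> carrier G" "l \<in> carrier G"
      "A = coset g" "B = coset h" "C = coset l"
      using ABC unfolding quotient_carrier by blast
    then show "Option.bind (pcomp Q B C) (pcomp Q A) = Option.bind (pcomp Q A B) (\<lambda>X. pcomp Q X C)"
      "Option.bind (pcomp Q B C) (pcomp Q A) \<noteq> None \<longleftrightarrow> composable Q A B \<and> composable Q B C"
      by (simp_all add: quotient_pcomp_if quotient_composable_iff mult_assoc)
  qed
  have units: "(\<exists>!E. is_identity Q E \<and> composable Q A E) \<and> (\<exists>!E. is_identity Q E \<and> composable Q E A)"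
    and inverses: "\<exists>B. is_inverse Q A B" if A: "A \<in> carrier Q" for A
  proof -
    obtain g where g: "g \<in> carrier G" "A = coset g" using A by (auto simp: quotient_carrier)
    show "(\<exists>!E. is_identity Q E \<and> composable Q A E) \<and> (\<exists>!E. is_identity Q E \<and> composable Q E A)"
      using g by (simp add: identity_composable_iff)
    show "\<exists>B. is_inverse Q A B" using g quotient_is_inverse by blast
  qed
  show ?thesis unfolding groupoid_def
  proof (intro conjI[OF _ conjI[OF _ conjI[OF _ conjI]]] ballI)
    show "\<forall>A B C. pcomp Q A B = Some C \<longrightarrow> A \<in> carrier Q \<and> B \<in> carrier Q \<and> C \<in> carrier Q"
      using closed by blast
  qed (rule assoc exists units inverses; assumption)+
qed

lemma quotient_pinv:
  assumes "g \<in> carrier G"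
  shows "pinv Q (coset g) = coset (\<i> g)"
proof -
  interpret Q: groupoid_calculus Q by unfold_locales (rule quotient_groupoid)
  show ?thesis using Q.pinv_eqI quotient_is_inverse assms by (simp add: quotient_carrier)
qed

text \<open>An isotropic subgroupoid identifies no two identities, so equations between identities of
  the quotient can be pulled back.\<close>

lemma identity_coset_inj:
  assumes "g \<in> carrier G" "l \<in> carrier G"
  shows "coset (\<d> g) = coset (\<d> l) \<longleftrightarrow> \<d> g = \<d> l" "coset (\<r> g) = coset (\<d> l) \<longleftrightarrow> \<r> g = \<d> l"
    "coset (\<d> g) = coset (\<r> l) \<longleftrightarrow> \<d> g = \<r> l" "coset (\<r> g) = coset (\<r> l) \<longleftrightarrow> \<r> g = \<r> l"
  using coset_eq_dom_ran(1) assms by (metis dom_closed ran_closed dom_ran_simps(1) dom_ran_simps(3))+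

end

section \<open>The third isomorphism theorem\<close>

locale nested_calculus =
  K: isotropic_calculus G K + H: normal_calculus G H for G :: "'a pmagma" and H K :: "'a set" +
  assumes nested: "K \<subseteq> H"
begin

abbreviation N where "N \<equiv> coset_image G K H"

text \<open>An \<open>hK\<close> that is an isotropy element at the range of \<open>gK\<close> comes from an isotropy
  element \<open>h\<close> at \<open>r(g)\<close>, as \<open>K\<close> does not identify identities. So conjugation in the
  quotient is the image of conjugation in \<open>G\<close>.\<close>

lemma image_normal: "normal_subgroupoid N K.Q"
proof -
  have sub: "subgroupoid N K.Q"
  proof -
    have "N \<subseteq> carrier K.Q" by (auto simp: coset_image_def K.quotient_carrier)
    moreover have "N \<noteq> {}"
      using H.normal by (auto simp: coset_image_def normal_subgroupoid_def subgroupoid_def)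
    moreover have "pinv K.Q A \<in> N" if "A \<in> N" for A
      using that K.quotient_pinv by (auto simp: coset_image_def)
    moreover have "pmult K.Q A B \<in> N" if AB: "A \<in> N" "B \<in> N" and c: "composable K.Q A B" for A B
    proof -
      obtain h k where *: "h \<in> H" "k \<in> H" "A = K.coset h" "B = K.coset k"
        using AB unfolding coset_image_def by blast
      then show ?thesis
        using c by (simp add: coset_image_def K.quotient_composable_iff K.quotient_pmult)
    qed
    ultimately show ?thesis using K.quotient_groupoid by (simp add: subgroupoid_def)
  qed
  have "conjugate_set K.Q N A \<noteq> {} \<and> conjugate_set K.Q N A \<subseteq> N" if A: "A \<in> carrier K.Q" for A
  proof -
    obtain g where g: "g \<in> carrier G" "A = K.coset g" using A by (auto simp: K.quotient_carrier)
    have "K.coset (ran_id G g) \<in> N \<inter> isotropy K.Q (ran_id K.Q A)"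
      using g H.wide[of g]
      by (simp add: coset_image_def isotropy_def K.quotient_dom K.quotient_ran K.quotient_carrier)
    then have "conjugate_set K.Q N A \<noteq> {}" unfolding conjugate_set_def by blast
    moreover have "conjugate_set K.Q N A \<subseteq> N"
    proof
      fix X assume "X \<in> conjugate_set K.Q N A"
      then obtain h where h: "h \<in> H" "K.coset h \<in> isotropy K.Q (ran_id K.Q A)"
        and X: "X = pmult K.Q (pmult K.Q (pinv K.Q A) (K.coset h)) A"
        by (auto simp: conjugate_set_def coset_image_def)
      have e: "dom_id G h = ran_id G g" "ran_id G h = ran_id G g"
        using h g by (auto simp: isotropy_def K.quotient_dom K.quotient_ran K.identity_coset_inj)
      have "X = K.coset (pmult G (pmult G (pinv G g) h) g)"
        unfolding X using g h e by (simp add: K.quotient_pinv K.quotient_pmult)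
      then show "X \<in> N" using H.conjugate_closed[OF g(1) h(1) e] by (simp add: coset_image_def)
    qed
    ultimately show ?thesis by blast
  qed
  then show ?thesis using sub by (simp add: normal_subgroupoid_def)
qed

text \<open>This describes the coset of \<open>H/K\<close> through \<open>gK\<close> by \<open>gH\<close> alone, which makes
  \<open>X \<mapsto> {xK | x \<in> X}\<close> the inverse of the union map in the final isomorphism.\<close>

lemma coset_of_cosets:
  assumes g: "g \<in> carrier G"
  shows "left_coset K.Q N (K.coset g) = K.coset ` H.coset g"
proof -
  have "left_coset K.Q N (K.coset g)
      = {pmult K.Q (K.coset g) (K.coset h) | h. h \<in> H \<and> ran_id K.Q (K.coset h) = dom_id K.Q (K.coset g)}"
    by (auto simp: left_coset_def[of K.Q] coset_image_def)
  also have "\<dots> = {K.coset (pmult G g h) | h. h \<in> H \<and> ran_id G h = dom_id G g}"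
    using g by (force simp: K.quotient_dom K.quotient_ran K.identity_coset_inj K.quotient_pmult)
  also have "\<dots> = K.coset ` H.coset g" by (auto simp: left_coset_def[of G H])
  finally show ?thesis .
qed

lemma Union_cosets:
  assumes g: "g \<in> carrier G"
  shows "\<Union> (K.coset ` H.coset g) = H.coset g"
proof
  show "H.coset g \<subseteq> \<Union> (K.coset ` H.coset g)"
    using K.self_in_coset H.coset_subset[OF g] by blast
  show "\<Union> (K.coset ` H.coset g) \<subseteq> H.coset g"
  proof
    fix x assume "x \<in> \<Union> (K.coset ` H.coset g)"
    then obtain y where y: "y \<in> H.coset g" "x \<in> K.coset y" by blast
    have "x \<in> H.coset y" using y(2) nested by (auto simp: left_coset_def)
    then show "x \<in> H.coset g" using y(1) g H.coset_eq_iff H.coset_subset by blast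
  qed
qed

theorem quotient_of_quotient:
  "groupoid_isomorphic (quotient_groupoid K.Q N) (quotient_groupoid G H)"
proof -
  interpret N: normal_calculus K.Q N
    using K.quotient_groupoid image_normal by unfold_locales
  let ?QN = "quotient_groupoid K.Q N" and ?QH = "quotient_groupoid G H"
  have carrier: "carrier ?QN = (\<lambda>g. K.coset ` H.coset g) ` carrier G"
    using coset_of_cosets by (simp add: N.quotient_carrier K.quotient_carrier image_image)
  have "bij_betw Union (carrier ?QN) (carrier ?QH)"
    by (rule bij_betw_byWitness[where f' = "\<lambda>X. K.coset ` X"])
      (auto simp: carrier H.quotient_carrier Union_cosets)
  moreover have "groupoid_hom ?QN ?QH Union"
  proof -
    have "composable ?QH (\<Union>X) (\<Union>Y) \<and> \<Union>(pmult ?QN X Y) = pmult ?QH (\<Union>X) (\<Union>Y)"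
      if XY: "composable ?QN X Y" for X Y
    proof -
      obtain A B where AB: "A \<in> carrier K.Q" "B \<in> carrier K.Q" "dom_id K.Q A = ran_id K.Q B"
        "X = N.coset A" "Y = N.coset B" "pmult ?QN X Y = N.coset (pmult K.Q A B)"
        using XY by (rule N.quotient_composableE)
      obtain g l where gl: "g \<in> carrier G" "l \<in> carrier G" "A = K.coset g" "B = K.coset l"
        using AB by (auto simp: K.quotient_carrier)
      have d: "dom_id G g = ran_id G l"
        using AB gl by (simp add: K.quotient_dom K.quotient_ran K.identity_coset_inj)
      have "\<Union>X = H.coset g" "\<Union>Y = H.coset l" "\<Union>(pmult ?QN X Y) = H.coset (pmult G g l)"
        using AB gl d by (simp_all add: K.quotient_pmult coset_of_cosets Union_cosets)
      then show ?thesis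
        using H.quotient_pcomp[OF gl(1,2) d] by (simp add: composable_def pmult_def)
    qed
    moreover have "Union ` carrier ?QN \<subseteq> carrier ?QH"
      by (auto simp: carrier H.quotient_carrier Union_cosets)
    ultimately show ?thesis unfolding groupoid_hom_def by blast
  qed
  ultimately show ?thesis unfolding groupoid_isomorphic_def by blast
qed

end

theorem theorem3p20:
  fixes G :: "'a pmagma" and H K :: "'a set"
  assumes "groupoid G"
    and "normal_subgroupoid H G"
    and "normal_subgroupoid K G"
    and "K \<subseteq> H"
    and "quotient_composability_well_defined G K"
  shows "normal_subgroupoid (coset_image G K H) (quotient_groupoid G K)
    \<and> groupoid_isomorphic (quotient_groupoid (quotient_groupoid G K) (coset_image G K H)) (quotient_groupoid G H)"
proof -
  interpret nested_calculus G H K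
    using assms by unfold_locales
  show ?thesis using image_normal quotient_of_quotient by blast
qed

end
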